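(* Fix $n\ge1$, and let the discrete-time effective path delay operator $\bar\Psi:\bar\Lambda^n\to\mathbb{R}_+^{n\times|\mathcal{P}|}$ and the mappings $\bar\varepsilon_{ij}^p(\cdot):\bar\Lambda^n\to\mathbb{R}_{++}$, $p\in\mathcal{P}_{ij}$, $(i,j)\in\mathcal{W}$, be continuous. Let $\Omega^n$ be the set of solutions of the discrete-time VT-BR-DUE problem. The following hold. 1. There exists at least one solution that satisfies the (P) property. 2. For every solution $\bar h^*$ that satisfies the (P) property, there exists $\delta>0$ such that $$\mathcal{B}_{\bar h^*}^{\delta}\cap\bar\Lambda^n\cap\operatorname{span}\{\mathbf{e}_l:\ l\in\mathcal{F}(\bar h^* )\}\subset\Omega^n,$$ where $\mathcal{B}_{\bar h^*}^{\delta}$ is the ball of radius $\delta$ centered at $\bar h^*$ and $\{\mathbf{e}_l\}_{l=1}^{n\times|\mathcal{P}|}$ is the natural basis of $\mathbb{R}^{n\times|\mathcal{P}|}$. 3. The set $\mathcal{B}_{\bar h^*}^{\delta}\cap\bar\Lambda^n\cap\operatorname{span}\{\mathbf{e}_l:\ l\in\mathcal{F}(\bar h^* )\}$ (with $\bar h^*$, $\delta$ as in item 2) is infinite, and all points in this set have the (P) property.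
   Context: $\mathcal{W}$ is a finite set of origin-destination (O-D) pairs; $\mathcal{P}$ is the finite set of paths, the disjoint union of the nonempty sets $\mathcal{P}_{ij}$, $(i,j)\in\mathcal{W}$; $Q_{ij}>0$ are given demands. $\mathbb{R}_+$ (resp. $\mathbb{R}_{++}$) denotes the nonnegative (resp. positive) reals. The feasible set is $$\Lambda=\Big\{h\in\big(L_+^2[t_0,t_f]\big)^{|\mathcal{P}|}:\ \sum_{p\in\mathcal{P}_{ij}}\int_{t_0}^{t_f}h_p(t)\,dt=Q_{ij}\ \ \forall (i,j)\in\mathcal{W}\Big\},$$ where $L^2_+$ denotes nonnegative $L^2$ functions. The effective path delay operator $\Psi:\Lambda\to(L_+^2[t_0,t_f])^{|\mathcal{P}|}$ gives the travel costs $\Psi_p(\cdot,h)$ (measurable, positive a.e., square integrable), and $\varepsilon_{ij}^p(\cdot):\Lambda\to\mathbb{R}_{++}$ are tolerance functionals. Discretization: $[t_0,t_f]$ is partitioned uniformly into $n$ subintervals $I_1,\dots,I_n$ of length $\delta t=(t_f-t_0)/n$. $\Lambda^n$ is the set of $h\in\Lambda$ with every $h_p$ constant on every $I_k$. To $h\in\Lambda^n$ corresponds $\bar h=(\bar h_p(k))\in\mathbb{R}_+^{n\times|\mathcal{P}|}$ with $\bar h_p(k)=h_p(t)$, $t\in I_k$; the set of such vectors is $$\bar\Lambda^n=\Big\{\bar h\in\mathbb{R}_+^{n\times|\mathcal{P}|}:\ \delta t\sum_{p\in\mathcal{P}_{ij}}\sum_{k=1}^n\bar h_p(k)=Q_{ij}\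 \ \forall(i,j)\in\mathcal{W}\Big\}.$$ For $\bar h\in\bar\Lambda^n$ with counterpart $h\in\Lambda^n$: $\bar\Psi_p(k,\bar h)=\frac{1}{|I_k|}\int_{I_k}\Psi_p(t,h)\,dt$, $\bar\varepsilon_{ij}^p(\bar h)=\varepsilon_{ij}^p(h)$, and $v_{ij}(\bar h)=\min_{1\le k\le n,\,p\in\mathcal{P}_{ij}}\bar\Psi_p(k,\bar h)$. Definition. $\bar h^*\in\bar\Lambda^n$ is a solution of the discrete-time VT-BR-DUE problem if for all $(i,j)\in\mathcal{W}$, $p\in\mathcal{P}_{ij}$, $1\le k\le n$: $\bar h_p^*(k)>0\Rightarrow\bar\Psi_p(k,\bar h^* )\in[v_{ij}(\bar h^* ),\,v_{ij}(\bar h^* )+\bar\varepsilon_{ij}^p(\bar h^* )]$. (P) property. A solution $\bar h^*$ has the (P) property if for all $(i,j)\in\mathcal{W}$, $p\in\mathcal{P}_{ij}$, $1\le k\le n$: $\bar h_p^*(k)>0\Rightarrow\bar\Psi_p(k,\bar h^* )<v_{ij}(\bar h^* )+\bar\varepsilon_{ij}^p(\bar h^* )$. Fix a bijection $\mathcal{O}:\{(I_k,p):1\le k\le n,\,p\in\mathcal{P}\}\to\{1,\dots,n\times|\mathcal{P}|\}$, used to label the coordinates of $\mathbb{R}^{n\times|\mathcal{P}|}$. For a solution $\bar h^*$ with the (P) property, $$\mathcal{F}(\bar h^* )=\{\mathcal{O}(I_k,p):\ \bar\Psi_p(k,\bar h^* )<v_{ij}(\bar h^* )+\bar\varepsilon_{ij}^p(\bar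 h^* ),\ p\in\mathcal{P}_{ij}\}.$$
   Formalization: In item 3, "is infinite" is asserted only when F(h* ) has more elements than there are O-D pairs; otherwise each pair has exactly one free label and the set is just {h*} (e.g. n = 1, one pair, one path), so the unconditional claim is false. *)

theory Defs
  imports "HOL-Analysis.Analysis"
begin

record ('v, 'p) network =
  ods    :: "('v \<times> 'v) set"
  paths  :: "'v \<times> 'v \<Rightarrow> 'p set"
  demand :: "'v \<times> 'v \<Rightarrow> real"
  t0     :: real
  tf     :: real
  delay  :: "('p \<Rightarrow> real \<Rightarrow> real) \<Rightarrow> 'p \<Rightarrow> real \<Rightarrow> real"  (* h, p, t \<mapsto> \<Psi>_p(t,h) *)
  tol    :: "'v \<times> 'v \<Rightarrow> 'p \<Rightarrow> ('p \<Rightarrow> real \<Rightarrow> real) \<Rightarrow> real"  (* (i,j), p, h \<mapsto> \<epsilon>_ij^p(h) *)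

definition all_paths :: "('v, 'p) network \<Rightarrow> 'p set" where
  "all_paths N = (\<Union>w\<in>ods N. paths N w)"

abbreviation horizon :: "('v, 'p) network \<Rightarrow> real measure" where
  "horizon N \<equiv> lebesgue_on {t0 N..tf N}"

(* Elements of L^2 are represented by functions; only their values on the horizon, up to null sets,
   are meaningful (see flow_eq). *)
definition L2_plus :: "('v, 'p) network \<Rightarrow> (real \<Rightarrow> real) set" where
  "L2_plus N = {f. f \<in> borel_measurable (horizon N) \<and>
                   integrable (horizon N) (\<lambda>t. (f t)\<^sup>2) \<and>
                   (AE t in horizon N. 0 \<le> f t)}"

definition flow_eq :: "('v, 'p) network \<Rightarrow> ('p \<Rightarrow> real \<Rightarrow> real) \<Rightarrow> ('p \<Rightarrow> real \<Rightarrow> real) \<Rightarrow> bool" where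
  "flow_eq N h h' \<longleftrightarrow> (\<forall>p\<in>all_paths N. AE t in horizon N. h p t = h' p t)"

definition Lambda :: "('v, 'p) network \<Rightarrow> ('p \<Rightarrow> real \<Rightarrow> real) set" where
  "Lambda N = {h. (\<forall>p\<in>all_paths N. h p \<in> L2_plus N) \<and>
                  (\<forall>w\<in>ods N. (\<Sum>p\<in>paths N w. integral\<^sup>L (horizon N) (h p)) = demand N w)}"

(* The last two conjuncts say that delay and tol depend on h only through the L^2 classes of its
   components. *)
definition network :: "('v, 'p) network \<Rightarrow> bool" where
  "network N \<longleftrightarrow>
     finite (ods N) \<and>
     (\<forall>w\<in>ods N. finite (paths N w) \<and> paths N w \<noteq> {}) \<and>
     disjoint_family_on (paths N) (ods N) \<and>
     (\<forall>w\<in>ods N. 0 < demand N w) \<and>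
     t0 N < tf N \<and>
     (\<forall>h\<in>Lambda N. \<forall>p\<in>all_paths N.
        delay N h p \<in> L2_plus N \<and> (AE t in horizon N. 0 < delay N h p t)) \<and>
     (\<forall>h\<in>Lambda N. \<forall>w\<in>ods N. \<forall>p\<in>paths N w. 0 < tol N w p h) \<and>
     (\<forall>h\<in>Lambda N. \<forall>h'\<in>Lambda N. flow_eq N h h' \<longrightarrow> flow_eq N (delay N h) (delay N h')) \<and>
     (\<forall>h\<in>Lambda N. \<forall>h'\<in>Lambda N. flow_eq N h h' \<longrightarrow>
        (\<forall>w\<in>ods N. \<forall>p\<in>paths N w. tol N w p h = tol N w p h'))"

definition dt :: "('v, 'p) network \<Rightarrow> nat \<Rightarrow> real" where
  "dt N n = (tf N - t0 N) / real n"

(* Half-open subintervals, except that the n-th one also contains the right endpoint. *)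
definition subint :: "('v, 'p) network \<Rightarrow> nat \<Rightarrow> nat \<Rightarrow> real set" where
  "subint N n k = {t0 N + (real k - 1) * dt N n ..< t0 N + real k * dt N n} \<union>
                  (if k = n then {tf N} else {})"

definition Lambda_n :: "('v, 'p) network \<Rightarrow> nat \<Rightarrow> ('p \<Rightarrow> real \<Rightarrow> real) set" where
  "Lambda_n N n = {h \<in> Lambda N. \<forall>p\<in>all_paths N. \<forall>k\<in>{1..n}. \<exists>c. \<forall>t\<in>subint N n k. h p t = c}"

(* The labelling identifies R^(n x |P|) with real ^ 'm: the coordinate hbar_p(k) of hbar is
   hbar $ lab (k, p).  Its existence forces CARD('m) = n * |P|. *)
definition labelling :: "('v, 'p) network \<Rightarrow> nat \<Rightarrow> (nat \<times> 'p \<Rightarrow> 'm::finite) \<Rightarrow> bool" where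
  "labelling N n lab \<longleftrightarrow> bij_betw lab ({1..n} \<times> all_paths N) UNIV"

definition Lambda_bar ::
    "('v, 'p) network \<Rightarrow> nat \<Rightarrow> (nat \<times> 'p \<Rightarrow> 'm::finite) \<Rightarrow> (real ^ 'm) set" where
  "Lambda_bar N n lab =
     {hb. (\<forall>l. 0 \<le> hb $ l) \<and>
          (\<forall>w\<in>ods N. dt N n * (\<Sum>p\<in>paths N w. \<Sum>k=1..n. hb $ lab (k, p)) = demand N w)}"

(* The counterpart in Lambda_n of a vector in Lambda_bar; see counterpart_in_Lambda_n and
   counterpart_eq. *)
definition counterpart ::
    "('v, 'p) network \<Rightarrow> nat \<Rightarrow> (nat \<times> 'p \<Rightarrow> 'm::finite) \<Rightarrow> real ^ 'm \<Rightarrow> 'p \<Rightarrow> real \<Rightarrow> real" where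
  "counterpart N n lab hb p t = (\<Sum>k=1..n. hb $ lab (k, p) * indicator (subint N n k) t)"

definition Psi_bar ::
    "('v, 'p) network \<Rightarrow> nat \<Rightarrow> (nat \<times> 'p \<Rightarrow> 'm::finite) \<Rightarrow> real ^ 'm \<Rightarrow> real ^ 'm" where
  "Psi_bar N n lab hb =
     (\<chi> l. case inv_into ({1..n} \<times> all_paths N) lab l of (k, p) \<Rightarrow>
        1 / measure lebesgue (subint N n k) *
        set_lebesgue_integral lebesgue (subint N n k) (delay N (counterpart N n lab hb) p))"

definition tol_bar ::
    "('v, 'p) network \<Rightarrow> nat \<Rightarrow> (nat \<times> 'p \<Rightarrow> 'm::finite) \<Rightarrow> 'v \<times> 'v \<Rightarrow> 'p \<Rightarrow> real ^ 'm \<Rightarrow> real" where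
  "tol_bar N n lab w p hb = tol N w p (counterpart N n lab hb)"

definition min_cost ::
    "('v, 'p) network \<Rightarrow> nat \<Rightarrow> (nat \<times> 'p \<Rightarrow> 'm::finite) \<Rightarrow> 'v \<times> 'v \<Rightarrow> real ^ 'm \<Rightarrow> real" where
  "min_cost N n lab w hb = Min ((\<lambda>(k, p). Psi_bar N n lab hb $ lab (k, p)) ` ({1..n} \<times> paths N w))"

definition is_solution ::
    "('v, 'p) network \<Rightarrow> nat \<Rightarrow> (nat \<times> 'p \<Rightarrow> 'm::finite) \<Rightarrow> real ^ 'm \<Rightarrow> bool" where
  "is_solution N n lab hb \<longleftrightarrow> hb \<in> Lambda_bar N n lab \<and>
     (\<forall>w\<in>ods N. \<forall>p\<in>paths N w. \<forall>k\<in>{1..n}. 0 < hb $ lab (k, p) \<longrightarrow>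
        Psi_bar N n lab hb $ lab (k, p)
          \<in> {min_cost N n lab w hb .. min_cost N n lab w hb + tol_bar N n lab w p hb})"

definition Omega_n ::
    "('v, 'p) network \<Rightarrow> nat \<Rightarrow> (nat \<times> 'p \<Rightarrow> 'm::finite) \<Rightarrow> (real ^ 'm) set" where
  "Omega_n N n lab = {hb. is_solution N n lab hb}"

definition P_property ::
    "('v, 'p) network \<Rightarrow> nat \<Rightarrow> (nat \<times> 'p \<Rightarrow> 'm::finite) \<Rightarrow> real ^ 'm \<Rightarrow> bool" where
  "P_property N n lab hb \<longleftrightarrow>
     (\<forall>w\<in>ods N. \<forall>p\<in>paths N w. \<forall>k\<in>{1..n}. 0 < hb $ lab (k, p) \<longrightarrow>
        Psi_bar N n lab hb $ lab (k, p) < min_cost N n lab w hb + tol_bar N n lab w p hb)"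

definition free_labels ::
    "('v, 'p) network \<Rightarrow> nat \<Rightarrow> (nat \<times> 'p \<Rightarrow> 'm::finite) \<Rightarrow> real ^ 'm \<Rightarrow> 'm set" where
  "free_labels N n lab hb =
     {lab (k, p) | w k p. w \<in> ods N \<and> p \<in> paths N w \<and> k \<in> {1..n} \<and>
        Psi_bar N n lab hb $ lab (k, p) < min_cost N n lab w hb + tol_bar N n lab w p hb}"

lemma counterpart_eq:
  assumes "network N" "k \<in> {1..n}" "t \<in> subint N n k"
  shows "counterpart N n lab hb p t = hb $ lab (k, p)"
proof -
  have d: "dt N n > 0" "real n * dt N n = tf N - t0 N"
    using assms(1,2) by (auto simp: dt_def network_def)
  have *: "t \<in> subint N n j \<longleftrightarrow> j = k" if j: "j \<in> {1..n}" for j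
  proof
    have lt: "False" if "i < m" "m \<le> n" "t \<in> subint N n i" "t \<in> subint N n m" for i m
    proof -
      have "real i \<le> real m - 1" using \<open>i < m\<close> by linarith
      then have a: "real i * dt N n \<le> (real m - 1) * dt N n"
        using d(1) by (intro mult_right_mono) auto
      have b: "real i * dt N n \<le> real n * dt N n" "(real m - 1) * dt N n < real n * dt N n"
        using that d(1) by auto
      show False using that a b d by (auto simp: subint_def split: if_splits)
    qed
    show "t \<in> subint N n j \<Longrightarrow> j = k"
      using lt[of j k] lt[of k j] assms j by (metis atLeastAtMost_iff linorder_neqE_nat)
  qed (use assms in auto)
  have "counterpart N n lab hb p t = (\<Sum>j=1..n. if j = k then hb $ lab (k, p) else 0)"
    unfolding counterpart_def by (rule sum.cong) (auto simp: * indicator_def)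
  also have "\<dots> = hb $ lab (k, p)" using assms(2) by simp
  finally show ?thesis .
qed

lemma counterpart_in_Lambda_n:
  fixes lab :: "nat \<times> 'p \<Rightarrow> 'm::finite"
  assumes N: "network N" and n: "1 \<le> n" and hb: "hb \<in> Lambda_bar N n lab"
  shows "counterpart N n lab hb \<in> Lambda_n N n"
proof -
  have d: "dt N n > 0" "real n * dt N n = tf N - t0 N"
    using assms(1,2) by (auto simp: dt_def network_def)
  have sub: "subint N n k \<subseteq> {t0 N..tf N}" if k: "k \<in> {1..n}" for k
  proof -
    have "real k * dt N n \<le> real n * dt N n" "0 \<le> (real k - 1) * dt N n"
      using k d(1) by auto
    then show ?thesis using d N by (auto simp: subint_def network_def)
  qed
  have lm: "subint N n k \<in> lmeasurable" for k
    unfolding subint_def by (intro fmeasurable.Un) (auto intro: bounded_set_imp_lmeasurable)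
  have meas: "measure lebesgue (subint N n k) = dt N n" if k: "k \<in> {1..n}" for k
  proof -
    have "measure lebesgue (subint N n k)
        = measure lebesgue {t0 N + (real k - 1) * dt N n ..< t0 N + real k * dt N n}"
      unfolding subint_def by (intro measure_Un_null_set) auto
    also have "\<dots> = dt N n"
      using d(1) by (simp add: measure_lborel_Ico algebra_simps)
    finally show ?thesis .
  qed
  have ind: "integrable (horizon N) (indicat_real (subint N n k))"
            "integral\<^sup>L (horizon N) (indicat_real (subint N n k)) = dt N n"
    if k: "k \<in> {1..n}" for k
  proof -
    have s: "subint N n k \<in> sets (horizon N)" and f: "emeasure (horizon N) (subint N n k) < \<infinity>"
      using sub[OF k] lm[of k]
      by (auto simp: sets_restrict_space_iff emeasure_restrict_space fmeasurable_def)
    then show "integrable (horizon N) (indicat_real (subint N n k))" by simp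
    show "integral\<^sup>L (horizon N) (indicat_real (subint N n k)) = dt N n"
      using sub[OF k] meas[OF k] lm[of k]
      by (subst Bochner_Integration.integral_indicator)
         (auto simp: measure_restrict_space Int_absorb2 Int_absorb1)
  qed
  have nn: "0 \<le> counterpart N n lab hb p t" for p t
    using hb unfolding counterpart_def Lambda_bar_def by (intro sum_nonneg) auto
  have int: "integrable (horizon N) (counterpart N n lab hb p)" for p
    unfolding counterpart_def using ind by (intro Bochner_Integration.integrable_sum) auto
  have val: "integral\<^sup>L (horizon N) (counterpart N n lab hb p)
      = dt N n * (\<Sum>k=1..n. hb $ lab (k, p))" for p
    unfolding counterpart_def using ind
    by (subst Bochner_Integration.integral_sum) (auto simp: sum_distrib_left mult.commute)
  have bd: "counterpart N n lab hb p t \<le> (\<Sum>k=1..n. hb $ lab (k, p))" for p t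
    using hb unfolding counterpart_def Lambda_bar_def
    by (intro sum_mono) (auto simp: indicator_def)
  have sq: "integrable (horizon N) (\<lambda>t. (counterpart N n lab hb p t)\<^sup>2)" for p
  proof (rule Bochner_Integration.integrable_bound)
    show "integrable (horizon N)
        (\<lambda>t. (\<Sum>k=1..n. hb $ lab (k, p)) * counterpart N n lab hb p t)"
      using int by simp
    show "(\<lambda>t. (counterpart N n lab hb p t)\<^sup>2) \<in> borel_measurable (horizon N)"
      using int[of p] by (intro borel_measurable_power) auto
    show "AE t in horizon N. norm ((counterpart N n lab hb p t)\<^sup>2)
        \<le> norm ((\<Sum>k=1..n. hb $ lab (k, p)) * counterpart N n lab hb p t)"
      using bd[where p = p] nn[where p = p]
      by (intro AE_I2) (auto simp: power2_eq_square intro!: mult_right_mono order_trans[OF _ abs_ge_self])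
  qed
  have "(\<Sum>p\<in>paths N w. integral\<^sup>L (horizon N) (counterpart N n lab hb p)) = demand N w"
    if "w \<in> ods N" for w
    using hb that unfolding Lambda_bar_def by (simp add: val sum_distrib_left[symmetric])
  then have "counterpart N n lab hb \<in> Lambda N"
    using nn int sq by (auto simp: Lambda_def L2_plus_def)
  then show ?thesis
    unfolding Lambda_n_def using counterpart_eq[OF N] by blast
qed

end

theory Submission
  imports Defs
begin

text \<open>
  The projected map \<open>h \<mapsto> proj (h - \<Psi> h)\<close> of the compact convex set of flow vectors into itself has
  a Brouwer fixed point, which solves the variational inequality for \<open>\<Psi>\<close>. Moving the flow of a used
  slot to a cheapest slot of the same origin-destination pair shows that all used slots have minimal
  cost, so a fixed point has the (P) property because the tolerances are positive. The inequalities
  in (P) are finitely many strict inequalities between continuous functions, hence persist nearby,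
  while the span condition prevents slots outside the free labels from becoming used. If there are
  more free labels than pairs, two of them belong to one pair, and flow can be shifted continuously
  between a used slot and another free slot of this pair.
\<close>

section \<open>Variational inequalities and coordinate subspaces\<close>

text \<open>That \<open>x\<close> is the point of the convex set \<open>S\<close> closest to
  \<open>x - F x\<close> means that \<open>- F x\<close> has nonpositive inner product with every
  \<open>y - x\<close>, \<open>y\<close> in \<open>S\<close>; this is the inequality.\<close>

lemma continuous_variational_inequality:
  fixes F :: "'a::euclidean_space \<Rightarrow> 'a"
  assumes "compact S" "convex S" "S \<noteq> {}" "continuous_on S F"
  obtains x where "x \<in> S" "\<And>y. y \<in> S \<Longrightarrow> 0 \<le> F x \<bullet> (y - x)"
proof -
  have cl: "closed S" using assms(1) by (rule compact_imp_closed)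
  have "continuous_on S (closest_point S \<circ> (\<lambda>x. x - F x))"
    using assms cl by (intro continuous_on_compose continuous_on_diff continuous_on_id
        continuous_on_closest_point) auto
  moreover have "closest_point S \<circ> (\<lambda>x. x - F x) \<in> S \<rightarrow> S"
    using closest_point_in_set[OF cl assms(3)] by auto
  ultimately obtain x where "x \<in> S" "(closest_point S \<circ> (\<lambda>x. x - F x)) x = x"
    by (rule brouwer[OF assms(1-3)])
  then have x: "x \<in> S" "closest_point S (x - F x) = x" by simp_all
  have "0 \<le> F x \<bullet> (y - x)" if "y \<in> S" for y
    using closest_point_dot[OF assms(2) cl that, of "x - F x"] x by (simp add: inner_minus_left)
  with x(1) show thesis by (rule that)
qed

text \<open>Turns membership in the span into a condition on the support; applied with the free
  labels as \<open>A\<close>.\<close>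

lemma span_axis_zero:
  fixes x :: "real ^ 'm::finite"
  assumes "x \<in> span ((\<lambda>l. axis l 1) ` A)" "i \<notin> A"
  shows "x $ i = 0"
  using assms(1)
proof (induction rule: span_induct_alt)
  case (step c y z)
  then obtain l where "l \<in> A" "y = axis l 1" by blast
  with step assms(2) have "y $ i = 0" by (auto simp: axis_def)
  with step show ?case by simp
qed simp

lemma in_span_axis:
  fixes x :: "real ^ 'm::finite"
  assumes "\<And>i. i \<notin> A \<Longrightarrow> x $ i = 0"
  shows "x \<in> span ((\<lambda>l. axis l 1) ` A)"
proof -
  have "x = (\<Sum>i\<in>UNIV. x $ i *\<^sub>R axis i 1)"
    by (metis basis_expansion scalar_mult_eq_scaleR)
  also have "\<dots> \<in> span ((\<lambda>l. axis l 1) ` A)"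
  proof (rule span_sum)
    fix i
    show "x $ i *\<^sub>R axis i 1 \<in> span ((\<lambda>l. axis l 1) ` A)"
      using assms[of i] by (cases "i \<in> A") (auto intro: span_scale span_base span_zero)
  qed
  finally show ?thesis .
qed

section \<open>Grouping the coordinates by origin-destination pair\<close>

locale discretized_network =
  fixes N :: "('v, 'p) network" and n :: nat and lab :: "nat \<times> 'p \<Rightarrow> 'm::finite"
  assumes net: "network N" and n_pos: "1 \<le> n" and labelling: "labelling N n lab"
begin

text \<open>These blocks partition the coordinates (\<open>labels_disjoint\<close>,
  \<open>labels_cover\<close>), so the feasible set is a product of scaled simplices, one per
  pair.\<close>

definition labels :: "'v \<times> 'v \<Rightarrow> 'm set" where
  "labels w = lab ` ({1..n} \<times> paths N w)"

lemma dt_pos: "0 < dt N n"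
  using net n_pos by (simp add: dt_def network_def)

lemma paths_subset: "w \<in> ods N \<Longrightarrow> paths N w \<subseteq> all_paths N"
  by (auto simp: all_paths_def)

text \<open>Injectivity of \<open>lab\<close> recovers the subinterval and the path; the path
  determines its pair because the path sets are disjoint.\<close>

lemma lab_eqD:
  assumes "lab (k, p) = lab (k', p')" "k \<in> {1..n}" "k' \<in> {1..n}"
    and "w \<in> ods N" "w' \<in> ods N" "p \<in> paths N w" "p' \<in> paths N w'"
  shows "w = w' \<and> k = k' \<and> p = p'"
proof -
  have "inj_on lab ({1..n} \<times> all_paths N)"
    using labelling by (auto simp: labelling_def bij_betw_def)
  moreover have "p \<in> all_paths N" "p' \<in> all_paths N"
    using assms paths_subset by blast+
  ultimately have "k = k'" "p = p'"
    using assms(1-3) by (auto dest: inj_onD)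
  moreover have "w = w'"
    using assms(4-7) net \<open>p = p'\<close> by (auto simp: network_def disjoint_family_on_def)
  ultimately show ?thesis by simp
qed

lemma labels_disjoint:
  assumes "w \<in> ods N" "w' \<in> ods N" "l \<in> labels w" "l \<in> labels w'"
  shows "w = w'"
proof -
  from assms obtain k p k' p' where "lab (k, p) = lab (k', p')" "k \<in> {1..n}" "k' \<in> {1..n}"
    "p \<in> paths N w" "p' \<in> paths N w'"
    unfolding labels_def by force
  then show ?thesis using assms(1,2) lab_eqD by blast
qed

lemma labels_cover: "\<exists>w\<in>ods N. l \<in> labels w"
proof -
  have "l \<in> lab ` ({1..n} \<times> all_paths N)"
    using labelling by (auto simp: labelling_def bij_betw_def)
  then show ?thesis by (auto simp: all_paths_def labels_def)
qed

lemma labels_nonempty: "w \<in> ods N \<Longrightarrow> labels w \<noteq> {}"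
  using net n_pos by (auto simp: labels_def network_def)

lemma sum_paths_eq_sum_labels:
  assumes "w \<in> ods N"
  shows "(\<Sum>p\<in>paths N w. \<Sum>k=1..n. hb $ lab (k, p)) = (\<Sum>l\<in>labels w. hb $ l)"
proof -
  have "inj_on lab ({1..n} \<times> paths N w)"
    using labelling paths_subset[OF assms] unfolding labelling_def bij_betw_def
    by (meson Sigma_mono inj_on_subset order_refl)
  then have "(\<Sum>l\<in>labels w. hb $ l) = (\<Sum>(k, p)\<in>{1..n} \<times> paths N w. hb $ lab (k, p))"
    unfolding labels_def by (subst sum.reindex) (auto intro!: sum.cong)
  also have "\<dots> = (\<Sum>k=1..n. \<Sum>p\<in>paths N w. hb $ lab (k, p))"
    by (simp add: sum.cartesian_product)
  finally show ?thesis by (subst sum.swap) simp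
qed

section \<open>Geometry of the set of feasible flow vectors\<close>

text \<open>Dividing by the positive step length leaves one block sum per pair, the form used for
  the feasibility arguments below.\<close>

lemma Lambda_bar_iff:
  "hb \<in> Lambda_bar N n lab \<longleftrightarrow>
     (\<forall>l. 0 \<le> hb $ l) \<and> (\<forall>w\<in>ods N. (\<Sum>l\<in>labels w. hb $ l) = demand N w / dt N n)"
  using dt_pos by (simp add: Lambda_bar_def sum_paths_eq_sum_labels field_simps del: One_nat_def)

lemma sum_labels_axis:
  assumes "w \<in> ods N" "w' \<in> ods N" "l \<in> labels w'"
  shows "(\<Sum>i\<in>labels w. axis l (1::real) $ i) = (if w = w' then 1 else 0)"
proof (cases "w = w'")
  case True
  then show ?thesis using assms
    by (simp add: axis_def sum.delta)
next
  case False
  then have "l \<notin> labels w" using labels_disjoint assms by blast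
  then show ?thesis using False by (auto simp: axis_def intro!: sum.neutral)
qed

lemma convex_Lambda_bar: "convex (Lambda_bar N n lab)"
proof (rule convexI)
  fix x y :: "real ^ 'm" and u v :: real
  assume *: "x \<in> Lambda_bar N n lab" "y \<in> Lambda_bar N n lab" "0 \<le> u" "0 \<le> v" "u + v = 1"
  then have "(\<Sum>l\<in>labels w. (u *\<^sub>R x + v *\<^sub>R y) $ l) = (u + v) * (demand N w / dt N n)"
    if "w \<in> ods N" for w
    using that unfolding Lambda_bar_iff
    by (simp add: sum.distrib sum_distrib_left[symmetric] flip: distrib_right add_divide_distrib)
  with * show "u *\<^sub>R x + v *\<^sub>R y \<in> Lambda_bar N n lab"
    by (simp add: Lambda_bar_iff)
qed

lemma compact_Lambda_bar: "compact (Lambda_bar N n lab)"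
proof -
  \<comment> \<open>A nonnegative coordinate is at most its block sum; adding the block sums of all
    pairs gives one bound for every block.\<close>
  define M where "M = (\<Sum>w\<in>ods N. demand N w / dt N n)"
  have "x $ l \<le> M" if x: "x \<in> Lambda_bar N n lab" for x l
  proof -
    obtain w where w: "w \<in> ods N" "l \<in> labels w" using labels_cover by blast
    have "x $ l \<le> (\<Sum>i\<in>labels w. x $ i)"
      using x w by (intro member_le_sum) (auto simp: Lambda_bar_iff)
    also have "\<dots> = demand N w / dt N n" using x w by (simp add: Lambda_bar_iff)
    also have "\<dots> \<le> M"
      unfolding M_def using w net dt_pos
      by (intro member_le_sum) (auto simp: network_def less_imp_le)
    finally show ?thesis .
  qed
  then have "Lambda_bar N n lab \<subseteq> cbox 0 (\<chi> i. M)"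
    by (auto simp: mem_box_cart Lambda_bar_iff)
  moreover have "closed (Lambda_bar N n lab)"
  proof -
    have "Lambda_bar N n lab = (\<Inter>l. {x. 0 \<le> x $ l}) \<inter>
        (\<Inter>w\<in>ods N. {x. (\<Sum>l\<in>labels w. x $ l) = demand N w / dt N n})"
      by (auto simp: Lambda_bar_iff)
    also have "closed \<dots>"
      by (intro closed_Int closed_INT ballI closed_Collect_le closed_Collect_eq continuous_intros)
    finally show ?thesis .
  qed
  ultimately show ?thesis
    using bounded_cbox bounded_subset compact_eq_bounded_closed by blast
qed

lemma Lambda_bar_nonempty: "Lambda_bar N n lab \<noteq> {}"
proof -
  \<comment> \<open>A vertex of the product of simplices: each pair sends its whole demand through a
    single chosen slot.\<close>
  define f where "f w = (SOME l. l \<in> labels w)" for w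
  have f: "f w \<in> labels w" if "w \<in> ods N" for w
    unfolding f_def using labels_nonempty[OF that] by (simp add: some_in_eq)
  define x where "x = (\<Sum>w\<in>ods N. (demand N w / dt N n) *\<^sub>R axis (f w) (1::real))"
  have "0 \<le> x $ l" for l
    unfolding x_def using net dt_pos
    by (auto simp: network_def less_imp_le axis_def intro!: sum_nonneg)
  moreover have "(\<Sum>l\<in>labels w. x $ l) = demand N w / dt N n" if w: "w \<in> ods N" for w
  proof -
    have "(\<Sum>l\<in>labels w. x $ l) =
        (\<Sum>w'\<in>ods N. demand N w' / dt N n * (\<Sum>l\<in>labels w. axis (f w') 1 $ l))"
      unfolding x_def sum_component by (subst sum.swap) (simp add: sum_distrib_left)
    also have "\<dots> = (\<Sum>w'\<in>ods N. if w = w' then demand N w' / dt N n else 0)"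
      using w f by (intro sum.cong) (auto simp: sum_labels_axis)
    also have "\<dots> = demand N w / dt N n"
      using w net by (simp add: network_def)
    finally show ?thesis .
  qed
  ultimately show ?thesis using Lambda_bar_iff by blast
qed

text \<open>A shift within one pair preserves all block sums, and \<open>s \<le> hb $ r\<close>
  keeps slot \<open>r\<close> nonnegative. It serves both to compare costs in the variational
  inequality and to generate points near a solution.\<close>

lemma shift_in_Lambda_bar:
  assumes "hb \<in> Lambda_bar N n lab" "w \<in> ods N" "l \<in> labels w" "r \<in> labels w"
    and "0 \<le> s" "s \<le> hb $ r"
  shows "hb + s *\<^sub>R (axis l 1 - axis r 1) \<in> Lambda_bar N n lab"
proof -
  have "0 \<le> (hb + s *\<^sub>R (axis l 1 - axis r 1)) $ i" for i
    using assms by (auto simp: Lambda_bar_iff axis_def)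
  moreover have "(\<Sum>i\<in>labels w'. (hb + s *\<^sub>R (axis l 1 - axis r 1)) $ i) = demand N w' / dt N n"
    if "w' \<in> ods N" for w'
  proof -
    have "(\<Sum>i\<in>labels w'. (hb + s *\<^sub>R (axis l 1 - axis r 1)) $ i) =
       (\<Sum>i\<in>labels w'. hb $ i) +
         s * ((\<Sum>i\<in>labels w'. axis l 1 $ i) - (\<Sum>i\<in>labels w'. axis r 1 $ i))"
      by (simp add: sum.distrib sum_subtractf sum_distrib_left[symmetric])
    then show ?thesis
      using assms that by (simp add: sum_labels_axis Lambda_bar_iff)
  qed
  ultimately show ?thesis by (simp add: Lambda_bar_iff)
qed

section \<open>Minimal costs and existence of a solution with the (P) property\<close>

lemma min_cost_eq: "min_cost N n lab w hb = Min ((\<lambda>l. Psi_bar N n lab hb $ l) ` labels w)"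
  unfolding min_cost_def labels_def image_image by (simp add: case_prod_unfold)

lemma min_cost_le: "l \<in> labels w \<Longrightarrow> min_cost N n lab w hb \<le> Psi_bar N n lab hb $ l"
  by (simp add: min_cost_eq)

text \<open>Resolves the minimum into finitely many strict comparisons, so that limits can be taken
  coordinate by coordinate without proving \<open>min_cost\<close> continuous.\<close>

lemma less_min_cost_add_iff:
  assumes "w \<in> ods N"
  shows "a < min_cost N n lab w hb + e \<longleftrightarrow> (\<forall>m\<in>labels w. a < Psi_bar N n lab hb $ m + e)"
proof -
  have "a < min_cost N n lab w hb + e \<longleftrightarrow> a - e < min_cost N n lab w hb" by linarith
  also have "\<dots> \<longleftrightarrow> (\<forall>m\<in>labels w. a - e < Psi_bar N n lab hb $ m)"
    using labels_nonempty[OF assms] by (simp add: min_cost_eq)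
  finally show ?thesis by (auto simp: algebra_simps)
qed

text \<open>(P) gives the upper end of the cost interval and minimality the lower end, so only
  feasibility remains to be checked.\<close>

lemma in_Omega_n_iff_P:
  assumes "P_property N n lab hb"
  shows "hb \<in> Omega_n N n lab \<longleftrightarrow> hb \<in> Lambda_bar N n lab"
proof -
  have "Psi_bar N n lab hb $ lab (k, p)
      \<in> {min_cost N n lab w hb .. min_cost N n lab w hb + tol_bar N n lab w p hb}"
    if "w \<in> ods N" "p \<in> paths N w" "k \<in> {1..n}" "0 < hb $ lab (k, p)" for w p k
  proof -
    have "lab (k, p) \<in> labels w" using that unfolding labels_def by blast
    moreover have "Psi_bar N n lab hb $ lab (k, p) < min_cost N n lab w hb + tol_bar N n lab w p hb"
      using assms that unfolding P_property_def by blast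
    ultimately show ?thesis using min_cost_le[of "lab (k, p)" w hb] by auto
  qed
  then show ?thesis unfolding Omega_n_def is_solution_def by blast
qed

lemma exists_P_solution:
  assumes cont: "continuous_on (Lambda_bar N n lab) (Psi_bar N n lab)"
  shows "\<exists>hb\<in>Omega_n N n lab. P_property N n lab hb"
proof -
  obtain hb where hb: "hb \<in> Lambda_bar N n lab"
    and vi: "\<And>g. g \<in> Lambda_bar N n lab \<Longrightarrow> 0 \<le> Psi_bar N n lab hb \<bullet> (g - hb)"
    using continuous_variational_inequality[OF compact_Lambda_bar convex_Lambda_bar
        Lambda_bar_nonempty cont] by blast
  have cheapest: "Psi_bar N n lab hb $ r \<le> Psi_bar N n lab hb $ l"
    if "w \<in> ods N" "l \<in> labels w" "r \<in> labels w" "0 < hb $ r" for w l r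
  proof -
    \<comment> \<open>The competitor moves all flow of slot \<open>r\<close> to slot
      \<open>l\<close>. The inner product is the positive number \<open>hb $ r\<close> times the
      cost of \<open>l\<close> minus the cost of \<open>r\<close>.\<close>
    have "0 \<le> Psi_bar N n lab hb \<bullet> (hb $ r *\<^sub>R (axis l 1 - axis r 1))"
      using vi[OF shift_in_Lambda_bar[OF hb that(1-3), of "hb $ r"]] that(4) by simp
    then show ?thesis
      using that(4) by (simp add: inner_diff_right inner_axis zero_le_mult_iff)
  qed
  have "P_property N n lab hb"
    unfolding P_property_def
  proof (intro ballI impI)
    fix w p k assume *: "w \<in> ods N" "p \<in> paths N w" "k \<in> {1..n}" "0 < hb $ lab (k, p)"
    \<comment> \<open>\<open>network\<close> provides positive tolerances only on
      \<open>Lambda N\<close>, so the counterpart has to be placed there first.\<close>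
    have "counterpart N n lab hb \<in> Lambda N"
      using counterpart_in_Lambda_n[OF net n_pos hb] by (simp add: Lambda_n_def)
    then have "0 < tol_bar N n lab w p hb"
      using * net by (simp add: tol_bar_def network_def)
    moreover have "lab (k, p) \<in> labels w" using * unfolding labels_def by blast
    ultimately have "\<forall>m\<in>labels w.
        Psi_bar N n lab hb $ lab (k, p) < Psi_bar N n lab hb $ m + tol_bar N n lab w p hb"
      using cheapest[OF *(1) _ _ *(4)] by (smt (verit))
    then show
      "Psi_bar N n lab hb $ lab (k, p) < min_cost N n lab w hb + tol_bar N n lab w p hb"
      using less_min_cost_add_iff[OF *(1)] by blast
  qed
  with hb in_Omega_n_iff_P show ?thesis by blast
qed

section \<open>Persistence of free labels near a feasible vector\<close>

lemma free_labels_locally_free: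
  assumes cont: "continuous_on (Lambda_bar N n lab) (Psi_bar N n lab)"
    and cont_tol: "\<And>w p. w \<in> ods N \<Longrightarrow> p \<in> paths N w \<Longrightarrow>
           continuous_on (Lambda_bar N n lab) (tol_bar N n lab w p)"
    and hb: "hb \<in> Lambda_bar N n lab"
  obtains \<delta> where "0 < \<delta>"
    "\<And>g. g \<in> ball hb \<delta> \<inter> Lambda_bar N n lab \<Longrightarrow> free_labels N n lab hb \<subseteq> free_labels N n lab g"
proof -
  \<comment> \<open>Triples replace labels because the inequality of a slot refers to its pair and
    path; finiteness of \<open>I\<close> yields one radius for all of them.\<close>
  define I where "I = (SIGMA w:ods N. {1..n} \<times> paths N w)"
  define Q where "Q i g \<longleftrightarrow> (case i of (w, k, p) \<Rightarrow>
    Psi_bar N n lab g $ lab (k, p) < min_cost N n lab w g + tol_bar N n lab w p g)" for i g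
  have "finite (ods N)" "\<And>w. w \<in> ods N \<Longrightarrow> finite (paths N w)"
    using net by (simp_all add: network_def)
  then have "finite I" unfolding I_def by blast
  \<comment> \<open>With the implication inside, all triples are treated uniformly; those that are
    not free at \<open>hb\<close> are trivial.\<close>
  have ev: "\<forall>\<^sub>F g in at hb within Lambda_bar N n lab. Q i hb \<longrightarrow> Q i g" if "i \<in> I" for i
  proof (cases "Q i hb")
    case True
    obtain w k p where i: "i = (w, k, p)" "w \<in> ods N" "p \<in> paths N w"
      using \<open>i \<in> I\<close> unfolding I_def by blast
    have Psi_lim: "((\<lambda>g. Psi_bar N n lab g $ l) \<longlongrightarrow> Psi_bar N n lab hb $ l)
        (at hb within Lambda_bar N n lab)" for l
      using cont hb by (intro tendsto_vec_nth) (simp add: continuous_on_def)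
    have tol_lim: "(tol_bar N n lab w p \<longlongrightarrow> tol_bar N n lab w p hb)
        (at hb within Lambda_bar N n lab)"
      using cont_tol[OF i(2,3)] hb by (simp add: continuous_on_def)
    have "\<forall>\<^sub>F g in at hb within Lambda_bar N n lab. \<forall>m\<in>labels w.
        0 < Psi_bar N n lab g $ m + tol_bar N n lab w p g - Psi_bar N n lab g $ lab (k, p)"
      using True i less_min_cost_add_iff[OF i(2)]
      by (intro eventually_ball_finite ballI
          order_tendstoD(1)[OF tendsto_diff[OF tendsto_add[OF Psi_lim tol_lim] Psi_lim]])
         (auto simp: Q_def)
    then show ?thesis by (simp add: Q_def i less_min_cost_add_iff[OF i(2)] algebra_simps)
  qed simp
  have "\<forall>\<^sub>F g in at hb within Lambda_bar N n lab. \<forall>i\<in>I. Q i hb \<longrightarrow> Q i g"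
    using \<open>finite I\<close> ev by (intro eventually_ball_finite ballI)
  then obtain \<delta> where \<delta>: "0 < \<delta>"
    "\<And>g i. \<lbrakk>g \<in> Lambda_bar N n lab; g \<noteq> hb; dist g hb < \<delta>; i \<in> I; Q i hb\<rbrakk> \<Longrightarrow> Q i g"
    unfolding eventually_at by blast
  have "free_labels N n lab hb \<subseteq> free_labels N n lab g"
    if "g \<in> ball hb \<delta> \<inter> Lambda_bar N n lab" for g
  proof
    fix l assume "l \<in> free_labels N n lab hb"
    then obtain w k p where *: "l = lab (k, p)" "w \<in> ods N" "p \<in> paths N w" "k \<in> {1..n}"
      "Q (w, k, p) hb"
      unfolding free_labels_def Q_def by blast
    then have "(w, k, p) \<in> I" unfolding I_def by blast
    then have "Q (w, k, p) g"
      \<comment> \<open>\<open>eventually_at\<close> covers only a punctured neighbourhood, so the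
        centre is a separate case.\<close>
      using \<delta>(2)[of g "(w, k, p)"] * that by (cases "g = hb") (auto simp: dist_commute)
    with * show "l \<in> free_labels N n lab g"
      unfolding free_labels_def Q_def mem_Collect_eq prod.case by blast
  qed
  with \<delta>(1) show thesis by (rule that)
qed

text \<open>Recasts (P) as a condition on the support. Freeness of a label only asserts some triple
  with the strict inequality; by \<open>lab_eqD\<close> it is the given one.\<close>

lemma P_property_iff:
  "P_property N n lab hb \<longleftrightarrow> (\<forall>l. 0 < hb $ l \<longrightarrow> l \<in> free_labels N n lab hb)"
proof
  assume P: "P_property N n lab hb"
  show "\<forall>l. 0 < hb $ l \<longrightarrow> l \<in> free_labels N n lab hb"
  proof (intro allI impI)
    fix l assume l: "0 < hb $ l"
    obtain w where "w \<in> ods N" "l \<in> labels w" using labels_cover by blast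
    then obtain k p where "w \<in> ods N" "l = lab (k, p)" "k \<in> {1..n}" "p \<in> paths N w"
      unfolding labels_def by blast
    with P l show "l \<in> free_labels N n lab hb"
      unfolding P_property_def free_labels_def by blast
  qed
next
  assume F: "\<forall>l. 0 < hb $ l \<longrightarrow> l \<in> free_labels N n lab hb"
  show "P_property N n lab hb"
    unfolding P_property_def
  proof (intro ballI impI)
    fix w p k assume *: "w \<in> ods N" "p \<in> paths N w" "k \<in> {1..n}" "0 < hb $ lab (k, p)"
    then obtain w' p' k' where **: "lab (k, p) = lab (k', p')" "w' \<in> ods N" "p' \<in> paths N w'"
      "k' \<in> {1..n}"
      "Psi_bar N n lab hb $ lab (k', p') < min_cost N n lab w' hb + tol_bar N n lab w' p' hb"
      using F unfolding free_labels_def by blast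
    then have "w = w' \<and> k = k' \<and> p = p'"
      using * lab_eqD by blast
    then show "Psi_bar N n lab hb $ lab (k, p) < min_cost N n lab w hb + tol_bar N n lab w p hb"
      using ** by simp
  qed
qed

section \<open>Infinitely many nearby feasible vectors\<close>

lemma infinite_local_solutions:
  assumes hb: "hb \<in> Lambda_bar N n lab" and P: "P_property N n lab hb" and "0 < \<delta>"
    and many: "card (ods N) < card (free_labels N n lab hb)"
  shows "infinite (ball hb \<delta> \<inter> Lambda_bar N n lab \<inter>
           span ((\<lambda>l. axis l 1) ` free_labels N n lab hb))"
proof -
  let ?F = "free_labels N n lab hb"
  obtain f where f: "\<And>l. f l \<in> ods N" "\<And>l. l \<in> labels (f l)"
    using labels_cover by metis
  \<comment> \<open>Pigeonhole for the map \<open>f\<close> from labels to their pairs.\<close>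
  have "\<not> inj_on f ?F"
    using many f(1) net card_inj_on_le[of f ?F "ods N"] by (auto simp: network_def)
  then obtain l m where lm: "l \<in> ?F" "m \<in> ?F" "l \<noteq> m" "f l = f m"
    unfolding inj_on_def by blast
  define w where "w = f l"
  have w: "w \<in> ods N" "l \<in> labels w" "m \<in> labels w"
    using f lm(4) unfolding w_def by metis+
  \<comment> \<open>Positive demand forces some slot \<open>r\<close> of the pair to be used; by (P)
    it is free.\<close>
  have "0 < (\<Sum>i\<in>labels w. hb $ i)"
    using hb w(1) net dt_pos by (simp add: Lambda_bar_iff network_def)
  then obtain r where r: "r \<in> labels w" "0 < hb $ r"
    by (meson not_less sum_nonpos)
  then have rF: "r \<in> ?F" using P P_property_iff by blast
  \<comment> \<open>At least one of the two distinct labels \<open>l\<close> and \<open>m\<close>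
    differs from \<open>r\<close>.\<close>
  obtain q where q: "q \<in> ?F" "q \<in> labels w" "q \<noteq> r"
    using lm w by metis
  define g where "g s = hb + s *\<^sub>R (axis q 1 - axis r (1::real))" for s
  \<comment> \<open>The first bound keeps slot \<open>r\<close> nonnegative; the second keeps the
    shift inside the ball, as its direction has norm at most 2.\<close>
  define c where "c = min (hb $ r) (\<delta> / 2)"
  have "g s \<in> ball hb \<delta> \<inter> Lambda_bar N n lab \<inter> span ((\<lambda>l. axis l 1) ` ?F)"
    if "s \<in> {0<..<c}" for s
  proof (intro IntI)
    have "norm (axis q 1 - axis r (1::real)) \<le> 2"
      using norm_triangle_ineq4[of "axis q (1::real)" "axis r 1"] by (simp add: norm_axis_1)
    then have "s * norm (axis q 1 - axis r (1::real)) \<le> s * 2"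
      using that by (intro mult_left_mono) auto
    also have "\<dots> < \<delta>" using that by (simp add: c_def)
    finally show "g s \<in> ball hb \<delta>"
      using that by (simp add: g_def dist_norm)
    show "g s \<in> Lambda_bar N n lab"
      unfolding g_def using that q r w hb by (intro shift_in_Lambda_bar) (auto simp: c_def)
    have "g s $ i = 0" if "i \<notin> ?F" for i
    proof -
      have "hb $ i = 0" using that hb P P_property_iff Lambda_bar_iff
        by (metis order_le_less)
      then show ?thesis using that q(1) rF by (auto simp: g_def axis_def)
    qed
    then show "g s \<in> span ((\<lambda>l. axis l 1) ` ?F)"
      by (rule in_span_axis)
  qed
  then have "g ` {0<..<c} \<subseteq> ball hb \<delta> \<inter> Lambda_bar N n lab \<inter> span ((\<lambda>l. axis l 1) ` ?F)"
    by blast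
  moreover have "infinite (g ` {0<..<c})"
  proof -
    have "inj g"
    proof (rule injI)
      fix s t assume "g s = g t"
      then have "g s $ q = g t $ q" by simp
      then show "s = t" using q(3) by (simp add: g_def axis_def)
    qed
    moreover have "0 < c" using r(2) \<open>0 < \<delta>\<close> by (simp add: c_def)
    ultimately show ?thesis
      by (metis finite_imageD infinite_Ioo inj_on_subset subset_UNIV)
  qed
  ultimately show ?thesis using finite_subset by blast
qed

end

text \<open>Infinitude carries a cardinality condition because it can fail otherwise. Each pair has
  a used, hence free, slot, so there are at least as many free labels as pairs. In case of equality
  each pair has exactly one, its flow is fixed by the demand, and the set is just
  \<open>{hb}\<close>; this happens for \<open>n = 1\<close> with one path per pair.\<close>

theorem proposition6p6:
  fixes N :: "('v, 'p) network" and n :: nat and lab :: "nat \<times> 'p \<Rightarrow> 'm::finite"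
  assumes "network N"
    and "1 \<le> n"
    and "labelling N n lab"
    and "continuous_on (Lambda_bar N n lab) (Psi_bar N n lab)"
    and "\<And>w p. w \<in> ods N \<Longrightarrow> p \<in> paths N w \<Longrightarrow>
           continuous_on (Lambda_bar N n lab) (tol_bar N n lab w p)"
  shows "(\<exists>hb \<in> Omega_n N n lab. P_property N n lab hb) \<and>
         (\<forall>hb \<in> Omega_n N n lab. P_property N n lab hb \<longrightarrow>
            (\<exists>\<delta>>0.
               let S = ball hb \<delta> \<inter> Lambda_bar N n lab \<inter>
                       span ((\<lambda>l. axis l 1) ` free_labels N n lab hb)
               in S \<subseteq> Omega_n N n lab \<and>
                  (card (ods N) < card (free_labels N n lab hb) \<longrightarrow> infinite S) \<and>
                  (\<forall>g\<in>S. P_property N n lab g)))"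
proof (intro conjI ballI impI)
  interpret discretized_network N n lab
    using assms(1-3) by unfold_locales
  show "\<exists>hb \<in> Omega_n N n lab. P_property N n lab hb"
    using assms(4) by (rule exists_P_solution)
  fix hb assume "hb \<in> Omega_n N n lab" and P: "P_property N n lab hb"
  then have hb: "hb \<in> Lambda_bar N n lab" by (simp add: in_Omega_n_iff_P)
  obtain \<delta> where "0 < \<delta>" and \<delta>: "\<And>g. g \<in> ball hb \<delta> \<inter> Lambda_bar N n lab \<Longrightarrow>
      free_labels N n lab hb \<subseteq> free_labels N n lab g"
    using free_labels_locally_free[OF assms(4,5) hb] by blast
  \<comment> \<open>The span condition makes every used slot of \<open>g\<close> free at
    \<open>hb\<close>; closeness then makes it free at \<open>g\<close>.\<close>
  have PS: "P_property N n lab g"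
    if "g \<in> ball hb \<delta> \<inter> Lambda_bar N n lab \<inter> span ((\<lambda>l. axis l 1) ` free_labels N n lab hb)" for g
    unfolding P_property_iff using that \<delta>[of g] span_axis_zero[of g "free_labels N n lab hb"]
    by fastforce
  show "\<exists>\<delta>>0.
     let S = ball hb \<delta> \<inter> Lambda_bar N n lab \<inter> span ((\<lambda>l. axis l 1) ` free_labels N n lab hb)
     in S \<subseteq> Omega_n N n lab \<and>
        (card (ods N) < card (free_labels N n lab hb) \<longrightarrow> infinite S) \<and>
        (\<forall>g\<in>S. P_property N n lab g)"
    unfolding Let_def
    using \<open>0 < \<delta>\<close> PS in_Omega_n_iff_P infinite_local_solutions[OF hb P \<open>0 < \<delta>\<close>]
    by (intro exI[of _ \<delta>]) blast
qed

end
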